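(* Let $k\ge2$ and let $G$ be a $k$-uniform hypergraph with maximum degree $\Delta$ and average degree $d$, and let $\mathcal{Q}^*$ be its incidence $Q$-tensor. Then $$d\leq\frac{1}{k^{k-1}}\rho(\mathcal{Q}^{*})\leq \Delta,$$ with equality holding in either of these inequalities if and only if $G$ is regular.
   Context: A $k$-uniform hypergraph $G=(V,E)$ has finite vertex set $V=[n]=\{1,\dots,n\}$ and a set $E$ of $k$-element subsets of $V$ (the edges; no repeated edges). The degree $d_i$ of a vertex $i$ is the number of edges containing $i$; $\Delta=\max_i d_i$, $d=\frac1n\sum_i d_i$; $G$ is regular if all $d_i$ are equal. The incidence $Q$-tensor $\mathcal{Q}^*$ of $G$ is the order-$k$ dimension-$n$ tensor whose $(i_1,\dots,i_k)$-entry is the number of edges $e$ with $i_t\in e$ for all $t=1,\dots,k$ (indices may repeat). For a real order-$k$ dimension-$n$ tensor $\mathcal{T}$ and $x\in\mathbb{C}^n$, $(\mathcal{T}x)_i=\sum_{i_2,\dots,i_k=1}^n\mathcal{T}_{ii_2\cdots i_k}x_{i_2}\cdots x_{i_k}$; $\lambda\in\mathbb{C}$ is an eigenvalue of $\mathcal{T}$ if there is $0\ne x\in\mathbb{C}^n$ with $(\mathcal{T}x)_i=\lambda x_i^{k-1}$ for all $i$; $\rho(\mathcal{T})$ is the maximum modulus of an eigenvalue.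
   Formalization: That equality in the upper bound forces G to be regular is proved only for connected G, since it fails in general (k=2, n=3, single edge {1,2}: the normalized spectral radius and Δ are both 1, but vertex 3 is isolated); all else holds for every G with n ≥ 1. *)

theory Defs
  imports "HOL-Analysis.Analysis"
begin

text \<open>A hypergraph on the vertex set \<open>{1..n}\<close> is given by \<open>n\<close> and its set of edges.\<close>

definition uniform_hypergraph :: "nat \<Rightarrow> nat \<Rightarrow> nat set set \<Rightarrow> bool" where
  "uniform_hypergraph k n E \<longleftrightarrow> (\<forall>e\<in>E. e \<subseteq> {1..n} \<and> card e = k)"

definition vertex_degree :: "nat set set \<Rightarrow> nat \<Rightarrow> nat" where
  "vertex_degree E i = card {e \<in> E. i \<in> e}"

definition max_degree :: "nat \<Rightarrow> nat set set \<Rightarrow> nat" where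
  "max_degree n E = Max (vertex_degree E ` {1..n})"

definition avg_degree :: "nat \<Rightarrow> nat set set \<Rightarrow> real" where
  "avg_degree n E = (\<Sum>i=1..n. real (vertex_degree E i)) / real n"

definition regular_hypergraph :: "nat \<Rightarrow> nat set set \<Rightarrow> bool" where
  "regular_hypergraph n E \<longleftrightarrow> (\<forall>i\<in>{1..n}. \<forall>j\<in>{1..n}. vertex_degree E i = vertex_degree E j)"

definition connected_hypergraph :: "nat \<Rightarrow> nat set set \<Rightarrow> bool" where
  "connected_hypergraph n E \<longleftrightarrow>
     (\<forall>i\<in>{1..n}. \<forall>j\<in>{1..n}. (i, j) \<in> {(u, v). \<exists>e\<in>E. u \<in> e \<and> v \<in> e}\<^sup>*)"

text \<open>
  A real tensor of order \<open>k\<close> and dimension \<open>n\<close> is a function on index lists; only its values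
  on lists of length \<open>k\<close> with entries in \<open>{1..n}\<close> matter. Likewise a vector of dimension \<open>n\<close>
  is a function of which only the values on \<open>{1..n}\<close> matter.
\<close>

definition tensor_apply ::
  "nat \<Rightarrow> nat \<Rightarrow> (nat list \<Rightarrow> real) \<Rightarrow> (nat \<Rightarrow> complex) \<Rightarrow> nat \<Rightarrow> complex" where
  "tensor_apply k n T x i =
     (\<Sum>is\<in>{is. length is = k - 1 \<and> set is \<subseteq> {1..n}}.
        complex_of_real (T (i # is)) * prod_list (map x is))"

definition tensor_eigenvalue ::
  "nat \<Rightarrow> nat \<Rightarrow> (nat list \<Rightarrow> real) \<Rightarrow> complex \<Rightarrow> bool" where
  "tensor_eigenvalue k n T l \<longleftrightarrow>
     (\<exists>x. (\<exists>i\<in>{1..n}. x i \<noteq> 0) \<and>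
          (\<forall>i\<in>{1..n}. tensor_apply k n T x i = l * x i ^ (k - 1)))"

text \<open>\<open>GREATEST\<close> rather than \<open>Max\<close>, which is unspecified unless the set is known to be finite.\<close>

definition tensor_spectral_radius :: "nat \<Rightarrow> nat \<Rightarrow> (nat list \<Rightarrow> real) \<Rightarrow> real" where
  "tensor_spectral_radius k n T =
     (GREATEST r. \<exists>l. tensor_eigenvalue k n T l \<and> r = cmod l)"

definition incidence_Q_tensor :: "nat set set \<Rightarrow> nat list \<Rightarrow> real" where
  "incidence_Q_tensor E is = real (card {e \<in> E. set is \<subseteq> e})"

text \<open>
  Connectedness is needed for one implication only: that equality in the upper bound
  \<open>\<rho> / k ^ (k - 1) \<le> \<Delta>\<close> forces regularity. Without it this fails: for \<open>k = 2\<close>, \<open>n = 3\<close> and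
  the single edge \<open>{1, 2}\<close> one has \<open>\<rho> = 2\<close> and \<open>\<Delta> = 1\<close>, so the upper bound is attained,
  although vertex 3 is isolated. The two bounds, the equality case of the lower bound, and equality
  in both bounds for regular hypergraphs require no connectedness.
\<close>

end

theory Submission
  imports Defs
begin

text \<open>
  Write \<open>x(e) = (\<Sum>j\<in>e. x j)\<close>. Applying the incidence Q-tensor to \<open>x\<close> gives
  \<open>(Q x)\<^sub>i = (\<Sum>e\<ni>i. x(e) ^ (k - 1))\<close> (lemma \<open>tensor_apply_incidence_Q\<close>), which is the \<open>i\<close>-th
  partial derivative, divided by \<open>k\<close>, of \<open>F x = (\<Sum>e\<in>E. x(e) ^ k)\<close>. Put \<open>N x = (\<Sum>i=1..n. x i ^ k)\<close>.
  The degrees are \<open>d\<^sub>i\<close>, with average \<open>d\<close> and maximum \<open>\<Delta>\<close>.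

  The spectral radius is the maximum \<open>\<rho>\<close> of \<open>F x / N x\<close> over the nonzero vectors \<open>x \<ge> 0\<close>
  (lemma \<open>tensor_spectral_radius_eq\<close>). The maximum is attained by compactness, and the first-order
  conditions at a maximizer, including the one-sided condition at coordinates equal to \<open>0\<close>,
  say precisely that it is an eigenvector for \<open>\<rho>\<close> (lemma \<open>rayleigh_maximizer_stationary\<close>).
  Conversely, if \<open>z\<close> is an eigenvector for \<open>l\<close>, the triangle inequality and Euler's identity
  \<open>(\<Sum>i. x i * (Q x)\<^sub>i) = F x\<close>, for \<open>x\<close> the vector of moduli of \<open>z\<close>, give
  \<open>\<bar>l\<bar> * N x \<le> F x \<le> \<rho> * N x\<close>.

  Lower bound: the all-ones vector has \<open>F / N = k ^ (k - 1) * d\<close>. If this is \<open>\<rho>\<close>, the all-ones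
  vector is a maximizer, hence an eigenvector, and its eigenvalue equations say that every
  degree is \<open>\<rho> / k ^ (k - 1)\<close>.

  Upper bound: by the power mean inequality on each edge,
  \<open>F x \<le> k ^ (k - 1) * (\<Sum>i. d\<^sub>i * x i ^ k) \<le> k ^ (k - 1) * \<Delta> * N x\<close>. If a maximizer attains both
  equalities, it is constant on every edge, hence constant and nonzero when the hypergraph
  is connected, and then \<open>d\<^sub>i = \<Delta>\<close> for all \<open>i\<close>.
\<close>

section \<open>Power sums over edges\<close>

text \<open>The homogeneous form \<open>F\<close> of degree \<open>k\<close> whose gradient is \<open>k\<close> times the tensor action.\<close>

definition edge_form :: "nat \<Rightarrow> nat set set \<Rightarrow> (nat \<Rightarrow> real) \<Rightarrow> real" where
  "edge_form k E x = (\<Sum>e\<in>E. (\<Sum>j\<in>e. x j) ^ k)"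

text \<open>
  The \<open>i\<close>-th coordinate of the incidence Q-tensor applied to \<open>x\<close>, as a sum over the edges at \<open>i\<close>.
  The scalars are left general because it is used over both the reals and the complex numbers.
\<close>

definition link_form :: "nat \<Rightarrow> nat set set \<Rightarrow> (nat \<Rightarrow> 'a::comm_semiring_1) \<Rightarrow> nat \<Rightarrow> 'a" where
  "link_form k E x i = (\<Sum>e\<in>{e\<in>E. i \<in> e}. (\<Sum>j\<in>e. x j) ^ (k - 1))"

text \<open>The normalization \<open>N\<close>, the \<open>k\<close>-th power of the \<open>k\<close>-norm on nonnegative vectors.\<close>

definition power_total :: "nat \<Rightarrow> nat \<Rightarrow> (nat \<Rightarrow> real) \<Rightarrow> real" where
  "power_total k n x = (\<Sum>i=1..n. x i ^ k)"

lemma uniform_hypergraph_finite: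
  assumes "uniform_hypergraph k n E"
  shows "finite E" and "\<And>e. e \<in> E \<Longrightarrow> finite e" and "\<And>e. e \<in> E \<Longrightarrow> e \<subseteq> {1..n}"
    and "\<And>e. e \<in> E \<Longrightarrow> card e = k"
proof -
  show sub: "e \<subseteq> {1..n}" "card e = k" if "e \<in> E" for e
    using assms that by (auto simp: uniform_hypergraph_def)
  show "finite e" if "e \<in> E" for e
    using sub(1)[OF that] finite_subset by blast
  have "E \<subseteq> Pow {1..n}" using sub by blast
  then show "finite E" using finite_subset by blast
qed

text \<open>Double counting of the pairs formed by a vertex and an edge containing it.\<close>

lemma sum_incidences:
  assumes "uniform_hypergraph k n E"
  shows "(\<Sum>i=1..n. \<Sum>e\<in>{e\<in>E. i \<in> e}. g e i) = (\<Sum>e\<in>E. \<Sum>i\<in>e. g e i)"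
proof -
  note fin = uniform_hypergraph_finite[OF assms]
  have "(\<Sum>i=1..n. \<Sum>e\<in>{e\<in>E. i \<in> e}. g e i) = (\<Sum>e\<in>E. \<Sum>i\<in>{i\<in>{1..n}. i \<in> e}. g e i)"
    using fin(1) by (intro sum.swap_restrict) auto
  also have "\<dots> = (\<Sum>e\<in>E. \<Sum>i\<in>e. g e i)"
  proof (rule sum.cong[OF refl])
    fix e assume "e \<in> E"
    then have "{i\<in>{1..n}. i \<in> e} = e" using fin(3) by blast
    then show "(\<Sum>i\<in>{i\<in>{1..n}. i \<in> e}. g e i) = (\<Sum>i\<in>e. g e i)" by simp
  qed
  finally show ?thesis .
qed

text \<open>Euler's identity for the form \<open>F\<close>.\<close>

lemma sum_mult_link_form:
  assumes "uniform_hypergraph k n E" and "1 \<le> k"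
  shows "(\<Sum>i=1..n. x i * link_form k E x i) = edge_form k E x"
proof -
  have "(\<Sum>i=1..n. x i * link_form k E x i)
      = (\<Sum>e\<in>E. \<Sum>i\<in>e. x i * (\<Sum>j\<in>e. x j) ^ (k - 1))"
    unfolding link_form_def sum_distrib_left by (rule sum_incidences[OF assms(1)])
  also have "\<dots> = edge_form k E x"
    unfolding edge_form_def
    using assms(2) by (intro sum.cong refl) (simp flip: sum_distrib_right power_Suc)
  finally show ?thesis .
qed

text \<open>The expansion of a power of a sum, indexed by the lists of length \<open>m\<close> over \<open>A\<close>.\<close>

lemma sum_prod_list_lists:
  fixes x :: "'b \<Rightarrow> 'a::comm_semiring_1"
  assumes "finite A"
  shows "(\<Sum>is\<in>{is. length is = m \<and> set is \<subseteq> A}. prod_list (map x is)) = (\<Sum>j\<in>A. x j) ^ m"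
proof (induction m)
  case 0
  have "{is. length is = 0 \<and> set is \<subseteq> A} = {[]}" by auto
  then show ?case by simp
next
  case (Suc m)
  let ?L = "\<lambda>m. {is. length is = m \<and> set is \<subseteq> A}"
  have "bij_betw (\<lambda>(j, is). j # is) (A \<times> ?L m) (?L (Suc m))"
    by (rule bij_betwI[where g = "\<lambda>is. (hd is, tl is)"]) (auto simp: length_Suc_conv)
  then have "(\<Sum>is\<in>?L (Suc m). prod_list (map x is))
      = (\<Sum>(j, is)\<in>A \<times> ?L m. x j * prod_list (map x is))"
    by (subst sum.reindex_bij_betw[symmetric]) (auto intro!: sum.cong)
  also have "\<dots> = (\<Sum>j\<in>A. x j) * (\<Sum>is\<in>?L m. prod_list (map x is))"
    by (simp add: sum_product sum.cartesian_product)
  finally show ?case using Suc by simp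
qed

text \<open>
  An index list contributes once for each edge that contains it, so exchanging the sums leaves,
  for each edge at \<open>i\<close>, the sum over all lists in that edge, which is a power of \<open>x(e)\<close>.
\<close>

lemma tensor_apply_incidence_Q:
  assumes "uniform_hypergraph k n E"
  shows "tensor_apply k n (incidence_Q_tensor E) x i = link_form k E x i"
proof -
  note fin = uniform_hypergraph_finite[OF assms]
  let ?L = "\<lambda>A. {is. length is = k - 1 \<and> set is \<subseteq> A}"
  let ?p = "\<lambda>is. prod_list (map x is)"
  have finL: "finite (?L {1..n})"
    using finite_lists_length_eq[of "{1..n}" "k - 1"] by (simp add: conj_commute)
  have "complex_of_real (incidence_Q_tensor E (i # is)) * ?p is
      = (\<Sum>e\<in>{e\<in>{e\<in>E. i \<in> e}. set is \<subseteq> e}. ?p is)" for "is"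
    by (simp add: incidence_Q_tensor_def conj_assoc)
  then have "tensor_apply k n (incidence_Q_tensor E) x i
      = (\<Sum>is\<in>?L {1..n}. \<Sum>e\<in>{e\<in>{e\<in>E. i \<in> e}. set is \<subseteq> e}. ?p is)"
    unfolding tensor_apply_def by (intro sum.cong refl)
  also have "\<dots> = (\<Sum>e\<in>{e\<in>E. i \<in> e}. \<Sum>is\<in>{is\<in>?L {1..n}. set is \<subseteq> e}. ?p is)"
    using fin(1) finL by (intro sum.swap_restrict) auto
  also have "\<dots> = link_form k E x i"
    unfolding link_form_def
  proof (rule sum.cong[OF refl])
    fix e assume e: "e \<in> {e\<in>E. i \<in> e}"
    then have "{is\<in>?L {1..n}. set is \<subseteq> e} = ?L e" using fin(3) by blast
    then show "(\<Sum>is\<in>{is\<in>?L {1..n}. set is \<subseteq> e}. ?p is) = (\<Sum>j\<in>e. x j) ^ (k - 1)"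
      using sum_prod_list_lists[of e x "k - 1"] fin(2) e by simp
  qed
  finally show ?thesis .
qed

section \<open>The spectral radius as a maximum\<close>

text \<open>
  \<open>x\<close> is a nonnegative vector, nonzero on \<open>{1..n}\<close>, that maximizes the quotient \<open>F / N\<close> among all
  such vectors, and \<open>r\<close> is the maximum. The quotient is cleared of its denominator, so that vectors
  vanishing on \<open>{1..n}\<close> need not be excluded. Nonnegativity is required at every index; the
  values outside \<open>{1..n}\<close> play no other role.
\<close>

definition rayleigh_maximizer ::
  "nat \<Rightarrow> nat \<Rightarrow> nat set set \<Rightarrow> real \<Rightarrow> (nat \<Rightarrow> real) \<Rightarrow> bool" where
  "rayleigh_maximizer k n E r x \<longleftrightarrow>
     (\<forall>i. 0 \<le> x i) \<and> (\<exists>i\<in>{1..n}. x i \<noteq> 0) \<and> edge_form k E x = r * power_total k n x \<and>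
     (\<forall>y. (\<forall>i. 0 \<le> y i) \<longrightarrow> edge_form k E y \<le> r * power_total k n y)"

lemma power_total_pos:
  assumes "\<And>i. 0 \<le> x i" and "\<exists>i\<in>{1..n}. x i \<noteq> 0"
  shows "0 < power_total k n x"
proof -
  obtain i where "i \<in> {1..n}" "x i \<noteq> 0" using assms(2) by blast
  then have "0 < x i ^ k" using assms(1)[of i] by simp
  then show ?thesis
    unfolding power_total_def using \<open>i \<in> {1..n}\<close> assms(1) by (intro sum_pos2[of _ i]) auto
qed

text \<open>
  The form \<open>F\<close> is continuous on the vectors with entries in \<open>{0..1}\<close> and \<open>N = 1\<close>, which form a
  compact set in the product topology; homogeneity extends the bound to all nonnegative vectors.
\<close>

lemma exists_rayleigh_maximizer:
  assumes H: "uniform_hypergraph k n E" and k: "1 \<le> k" and n: "1 \<le> n"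
  shows "\<exists>r x. rayleigh_maximizer k n E r x"
proof -
  note fin = uniform_hypergraph_finite[OF H]
  let ?N = "power_total k n" and ?F = "edge_form k E"
  define B :: "(nat \<Rightarrow> real) set" where "B = Pi\<^sub>E UNIV (\<lambda>_. {0..1})"
  define K where "K = B \<inter> {x. ?N x = 1}"
  have "compactin (product_topology (\<lambda>_::nat. euclidean :: real topology) UNIV) B"
    unfolding B_def by (simp add: compactin_PiE)
  then have "compact B"
    by (simp add: euclidean_product_topology)
  moreover have "closed {x. ?N x = 1}"
    unfolding power_total_def
    by (intro closed_Collect_eq continuous_intros continuous_on_product_coordinates)
  ultimately have "compact K"
    unfolding K_def by blast
  moreover have "(\<lambda>i. if i = 1 then 1 else 0) \<in> K"
    using n k by (auto simp: K_def B_def power_total_def if_distrib[of "\<lambda>a. a ^ k"] zero_power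
        sum.delta cong: if_cong)
  then have "K \<noteq> {}" by blast
  moreover have "continuous_on K ?F"
    unfolding edge_form_def
    by (intro continuous_intros continuous_on_subset[OF continuous_on_product_coordinates]) auto
  ultimately obtain x where x: "x \<in> K" and max: "\<And>y. y \<in> K \<Longrightarrow> ?F y \<le> ?F x"
    using continuous_attains_sup[of K ?F] by blast
  have x0: "0 \<le> x i" for i using x by (auto simp: K_def B_def)
  have Nx: "?N x = 1" using x by (simp add: K_def)
  have "?F y \<le> ?F x * ?N y" if y0: "\<And>i. 0 \<le> y i" for y
  proof (cases "\<exists>i\<in>{1..n}. y i \<noteq> 0")
    case False
    then have "?F y = (\<Sum>e\<in>E. 0)"
      unfolding edge_form_def using fin(3) k
      by (intro sum.cong refl) (auto simp: subset_iff intro!: sum.neutral)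
    moreover have "?N y = 0"
      unfolding power_total_def using False k by (intro sum.neutral) auto
    ultimately show ?thesis by simp
  next
    case True
    define s where "s = ?N y"
    have s: "0 < s" unfolding s_def by (rule power_total_pos[OF y0 True])
    \<comment> \<open>Both forms have degree \<open>k\<close>, so dividing \<open>y\<close> by the \<open>k\<close>-th root of \<open>N y\<close> normalizes it.\<close>
    define c where "c = root k s"
    have c: "0 < c" "c ^ k = s" using s k by (auto simp: c_def)
    define z where "z = (\<lambda>i. if i \<in> {1..n} then y i / c else 0)"
    have z0: "0 \<le> z i" for i using y0 c by (simp add: z_def)
    have Nz: "?N z = 1"
      using s c by (simp add: power_total_def z_def power_divide s_def flip: sum_divide_distrib)
    have "z i \<le> 1" for i
    proof (cases "i \<in> {1..n}")
      case True
      then have "z i ^ k \<le> ?N z"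
        unfolding power_total_def using z0 by (intro member_le_sum) auto
      then show ?thesis using Nz z0 k by (simp add: power_le_one_iff)
    qed (auto simp: z_def)
    then have "z \<in> K" using z0 Nz by (auto simp: K_def B_def)
    then have "?F z \<le> ?F x" by (rule max)
    moreover have "?F z = ?F y / s"
    proof -
      have "(\<Sum>j\<in>e. z j) = (\<Sum>j\<in>e. y j) / c" if "e \<in> E" for e
        unfolding sum_divide_distrib using fin(3)[OF that]
        by (intro sum.cong refl) (auto simp: z_def)
      then show ?thesis
        by (simp add: edge_form_def power_divide c flip: sum_divide_distrib)
    qed
    ultimately show ?thesis using s by (simp add: s_def field_simps)
  qed
  moreover have "\<exists>i\<in>{1..n}. x i \<noteq> 0"
  proof (rule ccontr)
    assume "\<not> ?thesis"
    then have "?N x = 0"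
      unfolding power_total_def using k by (intro sum.neutral) auto
    then show False using Nx by simp
  qed
  ultimately have "rayleigh_maximizer k n E (?F x) x"
    unfolding rayleigh_maximizer_def using x0 Nx by auto
  then show ?thesis by blast
qed

lemma edge_form_has_partial_derivative:
  assumes "uniform_hypergraph k n E"
  shows "((\<lambda>t. edge_form k E (x(i := t))) has_real_derivative real k * link_form k E x i)
    (at (x i))"
proof -
  note fin = uniform_hypergraph_finite[OF assms]
  have "((\<lambda>t. (\<Sum>j\<in>e. (x(i := t)) j) ^ k) has_real_derivative
      (if i \<in> e then real k * (\<Sum>j\<in>e. x j) ^ (k - 1) else 0)) (at (x i))" if "e \<in> E" for e
  proof (cases "i \<in> e")
    case True
    have "(\<Sum>j\<in>e. (x(i := t)) j) = t + (\<Sum>j\<in>e - {i}. x j)" for t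
      using fin(2)[OF that] True by (simp add: sum.remove)
    moreover have "(\<Sum>j\<in>e. x j) = x i + (\<Sum>j\<in>e - {i}. x j)"
      using fin(2)[OF that] True by (simp add: sum.remove)
    ultimately show ?thesis
      using True by (auto intro!: derivative_eq_intros)
  next
    case False
    then have "(\<Sum>j\<in>e. (x(i := t)) j) = (\<Sum>j\<in>e. x j)" for t
      by (intro sum.cong) auto
    then show ?thesis using False by simp
  qed
  then have "((\<lambda>t. \<Sum>e\<in>E. (\<Sum>j\<in>e. (x(i := t)) j) ^ k) has_real_derivative
      (\<Sum>e\<in>E. if i \<in> e then real k * (\<Sum>j\<in>e. x j) ^ (k - 1) else 0)) (at (x i))"
    by (intro DERIV_sum)
  also have "(\<Sum>e\<in>E. if i \<in> e then real k * (\<Sum>j\<in>e. x j) ^ (k - 1) else 0)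
      = real k * link_form k E x i"
    using fin(1) unfolding link_form_def sum_distrib_left by (rule sum.inter_filter[symmetric])
  finally show ?thesis unfolding edge_form_def .
qed

lemma power_total_has_partial_derivative:
  assumes "i \<in> {1..n}"
  shows "((\<lambda>t. power_total k n (x(i := t))) has_real_derivative real k * x i ^ (k - 1)) (at (x i))"
proof -
  have "power_total k n (x(i := t)) = t ^ k + (\<Sum>j\<in>{1..n} - {i}. x j ^ k)" for t
    unfolding power_total_def using assms by (subst sum.remove[of _ i]) auto
  then show ?thesis
    by (auto intro!: derivative_eq_intros)
qed

text \<open>
  The first-order conditions at a maximizer. At a coordinate with \<open>x i = 0\<close> only increments to the
  right are admissible, which gives \<open>(Q x)\<^sub>i \<le> r * 0 ^ (k - 1) = 0\<close>; here \<open>k \<ge> 2\<close> is essential. As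
  \<open>(Q x)\<^sub>i \<ge> 0\<close>, equality holds there as well.
\<close>

lemma rayleigh_maximizer_stationary:
  assumes H: "uniform_hypergraph k n E" and k: "2 \<le> k"
    and M: "rayleigh_maximizer k n E r x" and i: "i \<in> {1..n}"
  shows "link_form k E x i = r * x i ^ (k - 1)"
proof -
  have x0: "\<And>j. 0 \<le> x j" using M by (simp add: rayleigh_maximizer_def)
  \<comment> \<open>Nonnegative for \<open>t \<ge> 0\<close> and zero at \<open>t = x i\<close>.\<close>
  define g where "g t = r * power_total k n (x(i := t)) - edge_form k E (x(i := t))" for t
  define D where "D = real k * (r * x i ^ (k - 1) - link_form k E x i)"
  have der: "(g has_real_derivative D) (at (x i))"
    unfolding g_def D_def
    by (rule derivative_eq_intros edge_form_has_partial_derivative[OF H]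
          power_total_has_partial_derivative[OF i] refl)+ (simp add: algebra_simps)
  have gx: "g (x i) = 0"
    using M by (simp add: g_def rayleigh_maximizer_def)
  have g0: "0 \<le> g t" if "0 \<le> t" for t
    using M x0 that by (auto simp: g_def rayleigh_maximizer_def)
  have "D = 0"
  proof (cases "x i = 0")
    case False
    then have "0 < x i" using x0[of i] by simp
    moreover have "g (x i) \<le> g t" if "\<bar>x i - t\<bar> < x i" for t
      using g0[of t] gx that by auto
    ultimately show ?thesis using DERIV_local_min[OF der] by blast
  next
    case True
    have "0 \<le> link_form k E x i"
      unfolding link_form_def by (intro sum_nonneg zero_le_power) (auto intro: x0)
    then have "D \<le> 0" using True k by (simp add: D_def zero_power)
    moreover have "\<not> D < 0"
    proof
      assume "D < 0"
      then obtain d where "d > 0" and d: "\<And>h. 0 < h \<Longrightarrow> h < d \<Longrightarrow> g (x i + h) < g (x i)"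
        using DERIV_neg_dec_right[OF der] by blast
      then have "g (d / 2) < 0" using d[of "d / 2"] True gx by simp
      then show False using g0[of "d / 2"] \<open>d > 0\<close> by simp
    qed
    ultimately show ?thesis by simp
  qed
  then show ?thesis using k by (simp add: D_def)
qed

lemma cmod_eigenvalue_le:
  assumes H: "uniform_hypergraph k n E" and k: "1 \<le> k"
    and M: "rayleigh_maximizer k n E r x"
    and ev: "tensor_eigenvalue k n (incidence_Q_tensor E) l"
  shows "cmod l \<le> r"
proof -
  obtain z where z: "\<exists>i\<in>{1..n}. z i \<noteq> 0"
    and eq: "\<And>i. i \<in> {1..n} \<Longrightarrow> link_form k E z i = l * z i ^ (k - 1)"
    using ev unfolding tensor_eigenvalue_def tensor_apply_incidence_Q[OF H] by blast
  define y where "y i = cmod (z i)" for i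
  have y: "\<And>i. 0 \<le> y i" "\<exists>i\<in>{1..n}. y i \<noteq> 0" using z by (auto simp: y_def)
  have le: "cmod l * y i ^ (k - 1) \<le> link_form k E y i" if "i \<in> {1..n}" for i
  proof -
    have "cmod l * y i ^ (k - 1) = cmod (link_form k E z i)"
      using eq[OF that] by (simp add: y_def norm_mult norm_power)
    also have "\<dots> \<le> (\<Sum>e\<in>{e\<in>E. i \<in> e}. cmod (\<Sum>j\<in>e. z j) ^ (k - 1))"
      unfolding link_form_def by (rule order_trans[OF norm_sum]) (simp add: norm_power)
    also have "\<dots> \<le> link_form k E y i"
      unfolding link_form_def y_def by (intro sum_mono power_mono norm_sum) auto
    finally show ?thesis .
  qed
  have "cmod l * power_total k n y = (\<Sum>i=1..n. y i * (cmod l * y i ^ (k - 1)))"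
    unfolding power_total_def sum_distrib_left using k
    by (intro sum.cong refl) (simp add: mult.left_commute flip: power_Suc)
  also have "\<dots> \<le> (\<Sum>i=1..n. y i * link_form k E y i)"
    using le y(1) by (intro sum_mono mult_left_mono)
  also have "\<dots> = edge_form k E y" by (rule sum_mult_link_form[OF H k])
  also have "\<dots> \<le> r * power_total k n y"
    using M y(1) by (simp add: rayleigh_maximizer_def)
  finally show ?thesis using power_total_pos[OF y] by simp
qed

lemma tensor_spectral_radius_eq:
  assumes H: "uniform_hypergraph k n E" and k: "2 \<le> k"
    and M: "rayleigh_maximizer k n E r x"
  shows "tensor_spectral_radius k n (incidence_Q_tensor E) = r"
proof -
  have x: "\<And>i. 0 \<le> x i" "\<exists>i\<in>{1..n}. x i \<noteq> 0" and Fx: "edge_form k E x = r * power_total k n x"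
    using M by (auto simp: rayleigh_maximizer_def)
  have "0 \<le> edge_form k E x"
    unfolding edge_form_def by (intro sum_nonneg zero_le_power) (auto intro: x)
  then have r: "0 \<le> r" using Fx power_total_pos[OF x, of k] by (simp add: zero_le_mult_iff)
  have "link_form k E (\<lambda>i. complex_of_real (x i)) i = complex_of_real (link_form k E x i)" for i
    by (simp add: link_form_def)
  then have "tensor_eigenvalue k n (incidence_Q_tensor E) (complex_of_real r)"
    unfolding tensor_eigenvalue_def tensor_apply_incidence_Q[OF H]
    using x(2) rayleigh_maximizer_stationary[OF H k M]
    by (intro exI[of _ "\<lambda>i. complex_of_real (x i)"]) auto
  then show ?thesis
    unfolding tensor_spectral_radius_def using r k
    by (intro Greatest_equality) (auto intro!: exI[of _ "complex_of_real r"] cmod_eigenvalue_le[OF H _ M])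
qed

section \<open>Power means\<close>

text \<open>
  The graph of a power function lies above its tangent at \<open>m\<close>. The difference of the two sides for
  \<open>Suc (Suc k)\<close> is \<open>a\<close> times the difference for \<open>Suc k\<close> plus \<open>(k + 1) * m ^ k * (a - m)\<^sup>2\<close>.
\<close>

lemma power_tangent_le:
  fixes a m :: real
  assumes "0 \<le> a" and "0 \<le> m"
  shows "m ^ Suc k + real (Suc k) * m ^ k * (a - m) \<le> a ^ Suc k"
proof (induction k)
  case (Suc k)
  have "a ^ Suc (Suc k) - (m ^ Suc (Suc k) + real (Suc (Suc k)) * m ^ Suc k * (a - m))
      = a * (a ^ Suc k - (m ^ Suc k + real (Suc k) * m ^ k * (a - m)))
        + real (Suc k) * m ^ k * (a - m)\<^sup>2"
    by (simp add: algebra_simps power2_eq_square)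
  moreover have "0 \<le> \<dots>" using assms Suc by (intro add_nonneg_nonneg mult_nonneg_nonneg) auto
  ultimately show ?case by linarith
qed simp

lemma power_tangent_less:
  fixes a m :: real
  assumes "0 \<le> a" and "0 \<le> m" and "a \<noteq> m" and "1 \<le> k"
  shows "m ^ Suc k + real (Suc k) * m ^ k * (a - m) < a ^ Suc k"
proof (cases "m = 0")
  case True
  then show ?thesis using assms by (simp add: zero_power)
next
  case False
  obtain j where j: "k = Suc j" using assms(4) by (cases k) auto
  have "a ^ Suc k - (m ^ Suc k + real (Suc k) * m ^ k * (a - m))
      = a * (a ^ Suc j - (m ^ Suc j + real (Suc j) * m ^ j * (a - m)))
        + real (Suc j) * m ^ j * (a - m)\<^sup>2"
    by (simp add: j algebra_simps power2_eq_square)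
  moreover have "0 \<le> a * (a ^ Suc j - (m ^ Suc j + real (Suc j) * m ^ j * (a - m)))"
    using assms power_tangent_le by (intro mult_nonneg_nonneg) auto
  moreover have "0 < real (Suc j) * m ^ j * (a - m)\<^sup>2"
    using False assms by simp
  ultimately show ?thesis by linarith
qed

text \<open>
  The power mean inequality with its equality case, by summing the tangent inequality at the
  mean value \<open>m\<close>: the linear terms cancel.
\<close>

lemma power_sum_le_sum_power:
  fixes x :: "'a \<Rightarrow> real"
  assumes A: "finite A" "card A = k" and k: "2 \<le> k" and x0: "\<And>i. i \<in> A \<Longrightarrow> 0 \<le> x i"
  shows "(\<Sum>i\<in>A. x i) ^ k \<le> real k ^ (k - 1) * (\<Sum>i\<in>A. x i ^ k)"
    and "(\<Sum>i\<in>A. x i) ^ k = real k ^ (k - 1) * (\<Sum>i\<in>A. x i ^ k) \<Longrightarrow> i \<in> A \<Longrightarrow> j \<in> A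
      \<Longrightarrow> x i = x j"
proof -
  define m where "m = (\<Sum>i\<in>A. x i) / real k"
  obtain p where p: "k = Suc p" "1 \<le> p" using k by (cases k) auto
  have m0: "0 \<le> m" unfolding m_def using x0 by (intro divide_nonneg_nonneg sum_nonneg) auto
  define t where "t i = m ^ k + real k * m ^ p * (x i - m)" for i
  have "(\<Sum>i\<in>A. x i - m) = 0"
    using A k by (simp add: sum_subtractf m_def)
  then have tsum: "(\<Sum>i\<in>A. t i) = real k * m ^ k"
    using A by (simp add: t_def sum.distrib flip: sum_distrib_left)
  have sm: "(\<Sum>i\<in>A. x i) ^ k = real k ^ (k - 1) * (real k * m ^ k)"
    using p by (simp add: m_def power_divide)
  have le: "t i \<le> x i ^ k" if "i \<in> A" for i
    using power_tangent_le[of "x i" m p] x0[OF that] m0 p by (simp add: t_def)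
  show "(\<Sum>i\<in>A. x i) ^ k \<le> real k ^ (k - 1) * (\<Sum>i\<in>A. x i ^ k)"
    unfolding sm tsum[symmetric] using le by (intro mult_left_mono sum_mono) auto
  assume eq: "(\<Sum>i\<in>A. x i) ^ k = real k ^ (k - 1) * (\<Sum>i\<in>A. x i ^ k)" and ij: "i \<in> A" "j \<in> A"
  have "(\<Sum>i\<in>A. t i) = (\<Sum>i\<in>A. x i ^ k)"
    using eq k unfolding sm tsum by simp
  then have teq: "t i = x i ^ k" if "i \<in> A" for i
    using sum_mono_inv[of t A "\<lambda>i. x i ^ k"] le A(1) that by blast
  have "x i = m" if "i \<in> A" for i
    using power_tangent_less[of "x i" m p] teq[OF that] x0[OF that] m0 p by (force simp: t_def)
  then show "x i = x j" using ij by simp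
qed

section \<open>Degree bounds\<close>

text \<open>The handshake identity.\<close>

lemma sum_vertex_degree:
  assumes H: "uniform_hypergraph k n E"
  shows "(\<Sum>i=1..n. real (vertex_degree E i)) = real k * real (card E)"
proof -
  have "(\<Sum>i=1..n. real (vertex_degree E i)) = (\<Sum>i=1..n. \<Sum>e\<in>{e\<in>E. i \<in> e}. 1)"
    by (simp add: vertex_degree_def)
  also have "\<dots> = (\<Sum>e\<in>E. \<Sum>i\<in>e. 1)" by (rule sum_incidences[OF H])
  also have "\<dots> = real k * real (card E)"
    using uniform_hypergraph_finite(4)[OF H] by simp
  finally show ?thesis .
qed

text \<open>The all-ones vector has \<open>F / N = k ^ (k - 1) * d\<close>.\<close>

lemma edge_form_const_one:
  assumes H: "uniform_hypergraph k n E" and k: "1 \<le> k" and n: "1 \<le> n"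
  shows "edge_form k E (\<lambda>_. 1) = real k ^ (k - 1) * avg_degree n E * power_total k n (\<lambda>_. 1)"
proof -
  have "edge_form k E (\<lambda>_. 1) = real (card E) * real k ^ k"
    using uniform_hypergraph_finite(4)[OF H] by (simp add: edge_form_def)
  also have "real k ^ k = real k ^ (k - 1) * real k" using k by (simp add: power_eq_if)
  finally show ?thesis
    using n unfolding avg_degree_def sum_vertex_degree[OF H] power_total_def by simp
qed

lemma link_form_const_one:
  assumes H: "uniform_hypergraph k n E"
  shows "link_form k E (\<lambda>_. 1::real) i = real k ^ (k - 1) * real (vertex_degree E i)"
proof -
  have "link_form k E (\<lambda>_. 1::real) i = (\<Sum>e\<in>{e\<in>E. i \<in> e}. real k ^ (k - 1))"
    unfolding link_form_def using uniform_hypergraph_finite(4)[OF H] by (intro sum.cong) auto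
  then show ?thesis by (simp add: vertex_degree_def)
qed

lemma sum_edges_power:
  fixes x :: "nat \<Rightarrow> real"
  assumes H: "uniform_hypergraph k n E"
  shows "(\<Sum>e\<in>E. \<Sum>i\<in>e. x i ^ k) = (\<Sum>i=1..n. real (vertex_degree E i) * x i ^ k)"
  using sum_incidences[OF H, of "\<lambda>_ i. x i ^ k"] by (simp add: vertex_degree_def)

lemma vertex_degree_le_max_degree:
  "i \<in> {1..n} \<Longrightarrow> vertex_degree E i \<le> max_degree n E"
  unfolding max_degree_def by (intro Max_ge) auto

text \<open>The power mean inequality summed over all edges; in the case of equality it is tight on each edge.\<close>

lemma edge_form_le:
  assumes H: "uniform_hypergraph k n E" and k: "2 \<le> k" and x0: "\<And>i. 0 \<le> x i"
  shows "edge_form k E x \<le> real k ^ (k - 1) * (\<Sum>i=1..n. real (vertex_degree E i) * x i ^ k)"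
    and "edge_form k E x = real k ^ (k - 1) * (\<Sum>i=1..n. real (vertex_degree E i) * x i ^ k)
      \<Longrightarrow> e \<in> E \<Longrightarrow> i \<in> e \<Longrightarrow> j \<in> e \<Longrightarrow> x i = x j"
proof -
  note fin = uniform_hypergraph_finite[OF H]
  have eq: "real k ^ (k - 1) * (\<Sum>i=1..n. real (vertex_degree E i) * x i ^ k)
      = (\<Sum>e\<in>E. real k ^ (k - 1) * (\<Sum>i\<in>e. x i ^ k))"
    by (simp only: sum_edges_power[OF H, symmetric] sum_distrib_left[of _ _ E])
  have le: "(\<Sum>j\<in>e. x j) ^ k \<le> real k ^ (k - 1) * (\<Sum>i\<in>e. x i ^ k)" if "e \<in> E" for e
    by (rule power_sum_le_sum_power(1)[OF fin(2,4)[OF that] k x0])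
  then show "edge_form k E x
      \<le> real k ^ (k - 1) * (\<Sum>i=1..n. real (vertex_degree E i) * x i ^ k)"
    unfolding eq edge_form_def by (rule sum_mono)
  assume "edge_form k E x = real k ^ (k - 1) * (\<Sum>i=1..n. real (vertex_degree E i) * x i ^ k)"
    and e: "e \<in> E" "i \<in> e" "j \<in> e"
  then have "(\<Sum>j\<in>e. x j) ^ k = real k ^ (k - 1) * (\<Sum>i\<in>e. x i ^ k)"
    unfolding eq edge_form_def using sum_mono_inv[OF _ le e(1) fin(1)] by simp
  then show "x i = x j"
    using power_sum_le_sum_power(2)[OF fin(2,4)[OF e(1)] k x0 _ e(2,3)] by simp
qed

lemma regular_avg_degree_eq_max_degree:
  assumes "regular_hypergraph n E" and n: "1 \<le> n"
  shows "avg_degree n E = real (max_degree n E)"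
proof -
  define c where "c = vertex_degree E 1"
  have d: "vertex_degree E i = c" if "i \<in> {1..n}" for i
  proof -
    have "1 \<in> {1..n}" using n by simp
    then show ?thesis using assms(1) that unfolding c_def regular_hypergraph_def by blast
  qed
  have "vertex_degree E ` {1..n} = (\<lambda>_. c) ` {1..n}"
    using d by (intro image_cong) auto
  then have "max_degree n E = c" using n by (simp add: max_degree_def image_constant_conv)
  moreover have "(\<Sum>i=1..n. real (vertex_degree E i)) = (\<Sum>i=1..n. real c)"
    using d by (intro sum.cong) auto
  ultimately show ?thesis using n by (simp add: avg_degree_def)
qed

lemma connected_hypergraph_eq:
  assumes "connected_hypergraph n E" and step: "\<And>e i j. e \<in> E \<Longrightarrow> i \<in> e \<Longrightarrow> j \<in> e \<Longrightarrow> x i = x j"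
    and "i \<in> {1..n}" and "j \<in> {1..n}"
  shows "x i = x j"
proof -
  have "(i, j) \<in> {(u, v). \<exists>e\<in>E. u \<in> e \<and> v \<in> e}\<^sup>*"
    using assms by (simp add: connected_hypergraph_def)
  then show ?thesis by (induction rule: rtrancl_induct) (auto dest: step)
qed

theorem theorem32:
  fixes k n :: nat and E :: "nat set set"
  assumes "2 \<le> k" and "1 \<le> n" and "uniform_hypergraph k n E"
  defines "r \<equiv> 1 / real k ^ (k - 1) * tensor_spectral_radius k n (incidence_Q_tensor E)"
  shows "avg_degree n E \<le> r \<and> r \<le> real (max_degree n E) \<and>
    (avg_degree n E = r \<longleftrightarrow> regular_hypergraph n E) \<and>
    (regular_hypergraph n E \<longrightarrow> r = real (max_degree n E)) \<and>
    (connected_hypergraph n E \<longrightarrow> (r = real (max_degree n E) \<longleftrightarrow> regular_hypergraph n E))"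
proof -
  note k = assms(1) and n = assms(2) and H = assms(3)
  let ?D = "real (max_degree n E)" and ?c = "real k ^ (k - 1)"
  obtain s x where M: "rayleigh_maximizer k n E s x"
    using exists_rayleigh_maximizer[OF H _ n] k by auto
  have c: "0 < ?c" using k by simp
  have s: "s = ?c * r"
    unfolding r_def tensor_spectral_radius_eq[OF H k M] using c by simp
  have x0: "\<And>i. 0 \<le> x i" and xne: "\<exists>i\<in>{1..n}. x i \<noteq> 0"
    and Fx: "edge_form k E x = s * power_total k n x"
    and bound: "\<And>y. (\<And>i. 0 \<le> y i) \<Longrightarrow> edge_form k E y \<le> s * power_total k n y"
    using M by (auto simp: rayleigh_maximizer_def)
  have Nx: "0 < power_total k n x" by (rule power_total_pos[OF x0 xne])
  have N1: "0 < power_total k n (\<lambda>_. 1)" using n by (intro power_total_pos) auto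
  have F1: "edge_form k E (\<lambda>_. 1) = ?c * avg_degree n E * power_total k n (\<lambda>_. 1)"
    using edge_form_const_one[OF H _ n] k by simp
  \<comment> \<open>The quotient \<open>F / N\<close> at the all-ones vector is at most its maximum.\<close>
  have lower: "avg_degree n E \<le> r"
  proof -
    have "?c * avg_degree n E * power_total k n (\<lambda>_. 1) \<le> s * power_total k n (\<lambda>_. 1)"
      using bound[of "\<lambda>_. 1"] F1 by simp
    then show ?thesis using N1 c by (simp add: s)
  qed
  have degle: "(\<Sum>i=1..n. real (vertex_degree E i) * x i ^ k) \<le> ?D * power_total k n x"
    unfolding power_total_def sum_distrib_left
    using vertex_degree_le_max_degree[of _ n E] x0 by (intro sum_mono mult_right_mono) auto
  have Fle: "edge_form k E x \<le> ?c * (\<Sum>i=1..n. real (vertex_degree E i) * x i ^ k)"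
    by (rule edge_form_le(1)[OF H k x0])
  have rN: "edge_form k E x = ?c * (r * power_total k n x)" using Fx s by simp
  have upper: "r \<le> ?D"
  proof -
    have "r * power_total k n x \<le> ?D * power_total k n x"
      using Fle degle c unfolding rN by simp
    then show ?thesis using Nx by simp
  qed
  have avg_reg: "regular_hypergraph n E" if "avg_degree n E = r"
  proof -
    have "rayleigh_maximizer k n E s (\<lambda>_. 1)"
      using bound F1 n that by (auto simp: rayleigh_maximizer_def s)
    then have "?c * real (vertex_degree E i) = s" if "i \<in> {1..n}" for i
      using rayleigh_maximizer_stationary[OF H k _ that] link_form_const_one[OF H] by fastforce
    then have "real (vertex_degree E i) = r" if "i \<in> {1..n}" for i
      using that c unfolding s by (metis less_irrefl mult_cancel_left)
    then show ?thesis unfolding regular_hypergraph_def by (metis of_nat_eq_iff)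
  qed
  have reg: "avg_degree n E = r" "r = ?D" if "regular_hypergraph n E"
    using regular_avg_degree_eq_max_degree[OF that n] lower upper by auto
  have max_reg: "regular_hypergraph n E" if conn: "connected_hypergraph n E" and eq: "r = ?D"
  proof -
    \<comment> \<open>The chain from \<open>F x\<close> to \<open>\<Delta> * N x\<close> collapses, so both of its inequalities are tight.\<close>
    have deq: "(\<Sum>i=1..n. real (vertex_degree E i) * x i ^ k) = (\<Sum>i=1..n. ?D * x i ^ k)"
    proof (rule antisym)
      show "(\<Sum>i=1..n. real (vertex_degree E i) * x i ^ k) \<le> (\<Sum>i=1..n. ?D * x i ^ k)"
        using degle by (simp add: power_total_def sum_distrib_left)
      show "(\<Sum>i=1..n. ?D * x i ^ k) \<le> (\<Sum>i=1..n. real (vertex_degree E i) * x i ^ k)"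
        using Fle c unfolding rN eq mult_le_cancel_left_pos[OF c]
        by (simp add: power_total_def sum_distrib_left)
    qed
    then have "edge_form k E x = ?c * (\<Sum>i=1..n. real (vertex_degree E i) * x i ^ k)"
      by (simp only: rN eq power_total_def sum_distrib_left)
    then have edge_const: "x i = x j" if "e \<in> E" "i \<in> e" "j \<in> e" for e i j
      using edge_form_le(2)[OF H k x0 _ that] by simp
    have const: "x i = x j" if "i \<in> {1..n}" "j \<in> {1..n}" for i j
      using connected_hypergraph_eq[where x = x, OF conn edge_const that] .
    have "vertex_degree E i = max_degree n E" if i: "i \<in> {1..n}" for i
    proof -
      have "x i \<noteq> 0" using xne const[OF i] by auto
      moreover have "real (vertex_degree E i) * x i ^ k = ?D * x i ^ k"
      proof (rule sum_mono_inv[OF deq _ i])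
        show "real (vertex_degree E j) * x j ^ k \<le> ?D * x j ^ k" if "j \<in> {1..n}" for j
          using vertex_degree_le_max_degree[OF that] x0 by (intro mult_right_mono) auto
      qed simp
      ultimately show ?thesis by simp
    qed
    then show ?thesis by (simp add: regular_hypergraph_def)
  qed
  show ?thesis using lower upper avg_reg reg max_reg by blast
qed

end
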